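(* Let $f\colon \mathbb{R}_+\times X\rightarrow X$ be a $C^0$-semi flow on a Polish space $X$. If there is a point $\boldsymbol{x}\in X$ such that the motion $f(t,\boldsymbol{x})$ satisfies $\mathcal{C}_{\boldsymbol{x}}=X$, then the set $\{x\in X\colon \mathcal{C}_x=X\}$ is residual in $X$.
   Context: $\mathbb{R}_+=[0,\infty)$, and $X$ is equipped with a complete separable metric $d$. A $C^0$-semi flow on $X$ is a map $f\colon\mathbb{R}_+\times X\to X$ such that $f(0,x)=x$ for all $x\in X$; $f$ is (jointly) continuous, i.e. $t_n\to t_0$ in $\mathbb{R}_+$ and $x_n\to x_0$ in $X$ imply $f(t_n,x_n)\to f(t_0,x_0)$; and $f(t_2,f(t_1,x))=f(t_1+t_2,x)$ for all $x\in X$, $t_1,t_2\in\mathbb{R}_+$. The map $t\mapsto f(t,x)$ is called the motion starting at $x$. For $E\subseteq X$ put $\boldsymbol{P}(f(t,x)\in E)=\lim_{T\to+\infty}\frac1T\int_0^T\mathds{1}_E(f(t,x))\,dt$ (when the limit exists), where $\mathds{1}_E$ is the characteristic function of $E$. A closed set $C\subseteq X$ is a center of attraction of the motion $f(t,x)$ (as $t\to+\infty$) if $\boldsymbol{P}(f(t,x)\in B_\varepsilon(C))=1$ for every $\varepsilon>0$, where $B_\varepsilon(C)$ is the $\varepsilon$-neighborhood of $C$ in $X$. It is the minimal center of attraction of $f(t,x)$, denoted $\mathcal{C}_x$, if no proper subset of it is also a center of attraction of $f(t,x)$. Thus $\mathcal{C}_x=X$ means that $X$ is the minimal center of attraction of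 the motion $f(t,x)$. A subset of $X$ is residual if it contains a dense $G_\delta$ subset of $X$. *)

theory Defs
  imports "HOL-Analysis.Analysis"
begin

text \<open>Time is \<^typ>\<open>real\<close>, but only the values of \<open>f\<close> at times \<open>t \<ge> 0\<close> matter; nothing below looks
  at negative times.\<close>

definition semiflow :: "(real \<Rightarrow> 'a::topological_space \<Rightarrow> 'a) \<Rightarrow> bool" where
  "semiflow f \<longleftrightarrow>
     (\<forall>x. f 0 x = x) \<and>
     continuous_on ({0..} \<times> UNIV) (\<lambda>(t, x). f t x) \<and>
     (\<forall>x. \<forall>t1\<ge>0. \<forall>t2\<ge>0. f t2 (f t1 x) = f (t1 + t2) x)"

text \<open>\<open>sojourn_prob f x E p\<close> reads \<open>P(f(t,x) \<in> E) = p\<close>, including that the limit exists.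
  The integrability clause excludes sets \<open>E\<close> for which the integral would be
  meaningless (and hence equal to \<open>0\<close> by convention).\<close>

definition sojourn_prob ::
  "(real \<Rightarrow> 'a \<Rightarrow> 'a) \<Rightarrow> 'a \<Rightarrow> 'a set \<Rightarrow> real \<Rightarrow> bool" where
  "sojourn_prob f x E p \<longleftrightarrow>
     (\<forall>T>0. set_integrable lebesgue {0..T} (\<lambda>t. indicat_real E (f t x))) \<and>
     ((\<lambda>T. 1 / T * (LINT t:{0..T}|lebesgue. indicat_real E (f t x))) \<longlongrightarrow> p) at_top"

definition eps_nbhd :: "real \<Rightarrow> 'a::metric_space set \<Rightarrow> 'a set" where
  "eps_nbhd \<epsilon> C = (\<Union>c\<in>C. ball c \<epsilon>)"

definition center_of_attraction ::
  "(real \<Rightarrow> 'a::metric_space \<Rightarrow> 'a) \<Rightarrow> 'a \<Rightarrow> 'a set \<Rightarrow> bool" where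
  "center_of_attraction f x C \<longleftrightarrow>
     closed C \<and> (\<forall>\<epsilon>>0. sojourn_prob f x (eps_nbhd \<epsilon> C) 1)"

definition minimal_center_of_attraction ::
  "(real \<Rightarrow> 'a::metric_space \<Rightarrow> 'a) \<Rightarrow> 'a \<Rightarrow> 'a set \<Rightarrow> bool" where
  "minimal_center_of_attraction f x C \<longleftrightarrow>
     center_of_attraction f x C \<and> (\<forall>D. D \<subset> C \<longrightarrow> \<not> center_of_attraction f x D)"

definition residual_set :: "'a::topological_space set \<Rightarrow> bool" where
  "residual_set S \<longleftrightarrow> (\<exists>G\<subseteq>S. gdelta_in euclidean G \<and> closure G = UNIV)"

end

theory Submission
  imports Defs
begin

text \<open>The motion of \<open>x\<close> has minimal center of attraction \<open>X\<close> iff the time averages of every bump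
  function around every point fail to tend to \<open>0\<close>; bumps centered in a countable dense set with
  radii \<open>1/(k+1)\<close> suffice. For a continuous \<open>\<phi>\<close> the time average up to \<open>T\<close> is continuous in the
  starting point, so \<open>limsup > c\<close>, in the form ``averages exceed \<open>c\<close> at arbitrarily large times'', is a
  \<open>G\<^sub>\<delta>\<close> condition. If the averages along the motion of \<open>x\<^sub>0\<close> exceed \<open>2c\<close> at arbitrarily large times,
  then those of every point of its orbit exceed \<open>c\<close>. Hence the countable intersection of these
  \<open>G\<^sub>\<delta>\<close> sets contains the orbit of \<open>x\<^sub>0\<close>, which is dense; the Baire category theorem is not used.\<close>

section \<open>Tent functions\<close>

text \<open>Continuous stand-in for the indicator of a ball: time averages of an indicator need not
  depend continuously on the starting point.\<close>

definition bump :: "'a::metric_space \<Rightarrow> real \<Rightarrow> 'a \<Rightarrow> real" where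
  "bump y r z = max 0 (1 - dist z y / r)"

lemma bump_nonneg: "0 \<le> bump y r z"
  by (simp add: bump_def)

lemma bump_le_one: "r > 0 \<Longrightarrow> bump y r z \<le> 1"
  by (simp add: bump_def)

lemma bump_pos_iff: "r > 0 \<Longrightarrow> 0 < bump y r z \<longleftrightarrow> z \<in> ball y r"
  by (auto simp: bump_def field_simps dist_commute less_max_iff_disj)

lemma bump_ge_half: "r > 0 \<Longrightarrow> z \<in> ball y (r / 2) \<Longrightarrow> 1 / 2 \<le> bump y r z"
  by (auto simp: bump_def field_simps dist_commute le_max_iff_disj)

lemma continuous_on_bump: "r > 0 \<Longrightarrow> continuous_on A (bump y r)"
  unfolding bump_def by (intro continuous_intros) auto

lemma open_eps_nbhd: "open (eps_nbhd e C)"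
  by (auto simp: eps_nbhd_def)

section \<open>Time averages and their continuity\<close>

definition time_avg ::
  "(real \<Rightarrow> 'a \<Rightarrow> 'a) \<Rightarrow> ('a \<Rightarrow> real) \<Rightarrow> 'a \<Rightarrow> real \<Rightarrow> real" where
  "time_avg f \<phi> x T = 1 / T * integral {0..T} (\<lambda>t. \<phi> (f t x))"

context
  fixes f :: "real \<Rightarrow> 'a::metric_space \<Rightarrow> 'a"
  assumes sf: "semiflow f"
begin

lemma continuous_on_motion: "A \<subseteq> {0..} \<Longrightarrow> continuous_on A (\<lambda>t. f t x)"
proof -
  assume A: "A \<subseteq> {0..}"
  have c: "continuous_on ({0..} \<times> UNIV) (\<lambda>(t, x). f t x)"
    using sf by (simp add: semiflow_def)
  have "continuous_on A (\<lambda>t. (\<lambda>(t, x). f t x) (t, x))"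
    by (rule continuous_on_compose2[OF c]) (use A in \<open>auto intro!: continuous_intros\<close>)
  then show ?thesis by simp
qed

lemma integrable_motion:
  assumes "continuous_on UNIV \<phi>" "0 \<le> a"
  shows "(\<lambda>t. \<phi> (f t x) :: real) integrable_on {a..b}"
proof (rule integrable_continuous_real)
  show "continuous_on {a..b} (\<lambda>t. \<phi> (f t x))"
    by (rule continuous_on_compose2[OF assms(1) continuous_on_motion])
      (use assms in auto)
qed

text \<open>The integrand is jointly continuous and the time interval compact, so integration
  preserves continuity in the starting point.\<close>

lemma continuous_time_avg:
  assumes "continuous_on UNIV \<phi>"
  shows "continuous_on UNIV (\<lambda>x. time_avg f \<phi> x T)"
proof -
  have c: "continuous_on ({0..} \<times> UNIV) (\<lambda>(t, x). f t x)"
    using sf by (simp add: semiflow_def)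
  have "continuous_on (UNIV \<times> cbox 0 T) (\<lambda>p. \<phi> ((\<lambda>(t, x). f t x) (snd p, fst p)))"
    by (rule continuous_on_compose2[OF assms], rule continuous_on_compose2[OF c])
      (auto intro!: continuous_intros)
  then have "continuous_on (UNIV \<times> cbox 0 T) (\<lambda>(x, t). \<phi> (f t x))"
    by (simp add: case_prod_unfold)
  from integral_continuous_on_param[OF this] show ?thesis
    unfolding time_avg_def by (intro continuous_intros) simp
qed

section \<open>Sojourn probabilities against time averages\<close>

text \<open>Settles the integrability clause of \<open>sojourn_prob\<close> for the open sets
  \<open>eps_nbhd \<epsilon> C\<close>: the indicator along a continuous motion is Borel measurable
  and bounded.\<close>

lemma set_integrable_indicator_open:
  assumes "open E"
  shows "set_integrable lebesgue {0..T} (\<lambda>t. indicat_real E (f t x))"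
proof -
  have "(\<lambda>t. f t x) \<in> borel_measurable (restrict_space borel {0..T})"
    by (intro borel_measurable_continuous_on_restrict continuous_on_motion) auto
  then have "(\<lambda>t. indicat_real E (f t x)) \<in> borel_measurable (restrict_space borel {0..T})"
    by (rule measurable_compose) (simp add: assms borel_measurable_indicator)
  then have "(\<lambda>t. indicat_real E (f t x)) \<in> borel_measurable (restrict_space lborel {0..T})"
    by (simp add: measurable_def space_restrict_space sets_restrict_space)
  then have "(\<lambda>t. indicat_real E (f t x)) \<in> borel_measurable (lebesgue_on {0..T})"
    by (simp add: borel_measurable_restrict_space_iff borel_measurable_if_D measurable_completion)
  then show ?thesis
    by (rule measurable_bounded_by_integrable_imp_absolutely_integrable[where g = "\<lambda>_. 1"])
      (auto simp: indicator_def)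
qed

text \<open>The hypothesis on \<open>\<phi>\<close> is scaled so that it fits a bump function, which is at least \<open>1/2\<close> on the
  ball of half its radius.\<close>

lemma sojourn_prob_oneI:
  assumes E: "open E" and \<phi>: "continuous_on UNIV \<phi>"
    and lim: "(time_avg f \<phi> x \<longlongrightarrow> 0) at_top"
    and le: "\<And>z. 1 - 2 * \<phi> z \<le> indicat_real E z"
  shows "sojourn_prob f x E 1"
  unfolding sojourn_prob_def
proof (intro conjI allI impI set_integrable_indicator_open E)
  let ?m = "\<lambda>T. 1 / T * (LINT t:{0..T}|lebesgue. indicat_real E (f t x))"
  have m: "1 - 2 * time_avg f \<phi> x T \<le> ?m T" "?m T \<le> 1" if "T > 0" for T
  proof -
    note si = set_lebesgue_integral_eq_integral[OF set_integrable_indicator_open[OF E, of T x]]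
    have i: "(\<lambda>t. 1 - 2 * \<phi> (f t x)) integrable_on {0..T}"
      by (rule integrable_motion) (auto intro!: continuous_intros \<phi>)
    have "integral {0..T} (\<lambda>t. 1 - 2 * \<phi> (f t x)) \<le> integral {0..T} (\<lambda>t. indicat_real E (f t x))"
      by (rule integral_le[OF i si(1)]) (rule le)
    moreover have "integral {0..T} (\<lambda>t. 1 - 2 * \<phi> (f t x))
        = T - 2 * integral {0..T} (\<lambda>t. \<phi> (f t x))"
      using that by (subst integral_diff) (auto intro!: integrable_motion continuous_intros \<phi>)
    moreover have "integral {0..T} (\<lambda>t. indicat_real E (f t x)) \<le> integral {0..T} (\<lambda>t. 1)"
      by (rule integral_le[OF si(1)]) (auto simp: indicator_def)
    ultimately have "T / T \<le> (integral {0..T} (\<lambda>t. indicat_real E (f t x))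
          + 2 * integral {0..T} (\<lambda>t. \<phi> (f t x))) / T"
        "integral {0..T} (\<lambda>t. indicat_real E (f t x)) / T \<le> T / T"
      using that by (auto intro!: divide_right_mono)
    then show "1 - 2 * time_avg f \<phi> x T \<le> ?m T" "?m T \<le> 1"
      using that by (auto simp: time_avg_def si(2) add_divide_distrib)
  qed
  show "(?m \<longlongrightarrow> 1) at_top"
  proof (rule tendsto_sandwich)
    show "((\<lambda>T. 1 - 2 * time_avg f \<phi> x T) \<longlongrightarrow> 1) at_top"
      using tendsto_diff[OF tendsto_const tendsto_mult[OF tendsto_const lim]] by force
    show "\<forall>\<^sub>F T in at_top. 1 - 2 * time_avg f \<phi> x T \<le> ?m T"
      using eventually_gt_at_top[of 0] by eventually_elim (rule m)
    show "\<forall>\<^sub>F T in at_top. ?m T \<le> 1"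
      using eventually_gt_at_top[of 0] by eventually_elim (rule m)
  qed simp
qed

text \<open>The complement of \<open>E\<close> is visited with asymptotic frequency 0, and
  \<open>\<phi>\<close> lies below its indicator.\<close>

lemma time_avg_tendsto_zeroI:
  assumes E: "open E" and \<phi>: "continuous_on UNIV \<phi>"
    and p: "sojourn_prob f x E 1"
    and \<phi>_bounds: "\<And>z. 0 \<le> \<phi> z" "\<And>z. \<phi> z \<le> 1 - indicat_real E z"
  shows "(time_avg f \<phi> x \<longlongrightarrow> 0) at_top"
proof -
  let ?m = "\<lambda>T. 1 / T * (LINT t:{0..T}|lebesgue. indicat_real E (f t x))"
  have m: "0 \<le> time_avg f \<phi> x T" "time_avg f \<phi> x T \<le> 1 - ?m T" if "T > 0" for T
  proof -
    note si = set_lebesgue_integral_eq_integral[OF set_integrable_indicator_open[OF E, of T x]]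
    have i: "(\<lambda>t. \<phi> (f t x)) integrable_on {0..T}"
      by (rule integrable_motion[OF \<phi>]) simp
    have "integral {0..T} (\<lambda>t. \<phi> (f t x)) \<le> integral {0..T} (\<lambda>t. 1 - indicat_real E (f t x))"
      by (rule integral_le[OF i]) (auto intro!: integrable_diff si(1) \<phi>_bounds)
    moreover have "integral {0..T} (\<lambda>t. 1 - indicat_real E (f t x))
        = T - integral {0..T} (\<lambda>t. indicat_real E (f t x))"
      using that by (subst integral_diff) (auto intro!: si(1))
    moreover have "0 \<le> integral {0..T} (\<lambda>t. \<phi> (f t x))"
      by (rule integral_nonneg[OF i]) (rule \<phi>_bounds)
    ultimately show "0 \<le> time_avg f \<phi> x T" "time_avg f \<phi> x T \<le> 1 - ?m T"
      using that by (auto simp: time_avg_def si(2) field_simps)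
  qed
  have lim: "(?m \<longlongrightarrow> 1) at_top"
    using p by (simp add: sojourn_prob_def)
  show ?thesis
  proof (rule tendsto_sandwich)
    show "\<forall>\<^sub>F T in at_top. time_avg f \<phi> x T \<le> 1 - ?m T"
      using eventually_gt_at_top[of 0] by eventually_elim (rule m)
    show "\<forall>\<^sub>F T in at_top. 0 \<le> time_avg f \<phi> x T"
      using eventually_gt_at_top[of 0] by eventually_elim (rule m)
    show "((\<lambda>T. 1 - ?m T) \<longlongrightarrow> 0) at_top"
      using tendsto_diff[OF tendsto_const lim, of 1] by simp
  qed simp
qed

section \<open>Minimality in terms of bump averages\<close>

text \<open>Otherwise the motion would spend a vanishing fraction of time in the ball of radius
  \<open>r / 2\<close>, and the complement of this ball would be a smaller center of
  attraction.\<close>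

lemma time_avg_not_tendsto_zero:
  assumes "minimal_center_of_attraction f x UNIV" and r: "r > 0"
  shows "\<not> (time_avg f (bump y r) x \<longlongrightarrow> 0) at_top"
proof
  assume lim: "(time_avg f (bump y r) x \<longlongrightarrow> 0) at_top"
  have "center_of_attraction f x (- ball y (r / 2))"
    unfolding center_of_attraction_def
  proof (intro conjI allI impI)
    fix e :: real assume e: "e > 0"
    show "sojourn_prob f x (eps_nbhd e (- ball y (r / 2))) 1"
    proof (rule sojourn_prob_oneI[OF open_eps_nbhd continuous_on_bump[OF r] lim])
      fix z
      show "1 - 2 * bump y r z \<le> indicat_real (eps_nbhd e (- ball y (r / 2))) z"
      \<comment> \<open>On the half ball the left side is at most 0; off it, \<open>z\<close> itself
        belongs to the neighborhood and the indicator is 1.\<close>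
      proof (cases "z \<in> ball y (r / 2)")
        case True
        then show ?thesis
          using bump_ge_half[OF r True] by (auto simp: indicator_def)
      next
        case False
        then have "z \<in> eps_nbhd e (- ball y (r / 2))"
          using e by (auto simp: eps_nbhd_def intro!: bexI[of _ z])
        then show ?thesis
          by (simp add: bump_nonneg)
      qed
    qed
  qed (simp add: closed_Compl)
  moreover have "- ball y (r / 2) \<subset> UNIV"
    using r centre_in_ball[of y "r / 2"] by (metis ComplD UNIV_I half_gt_zero psubsetI subset_UNIV)
  ultimately show False
    using assms(1) by (auto simp: minimal_center_of_attraction_def)
qed

text \<open>A proper closed \<open>D\<close> misses a ball around some \<open>y \<in> S\<close>. If
  \<open>D\<close> were a center of attraction, the fraction of time spent near \<open>D\<close>,
  where a narrow bump at \<open>y\<close> vanishes, would tend to 1, and the averages of this bump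
  to 0.\<close>

lemma minimal_center_of_attraction_UNIVI:
  assumes dense: "\<And>U. open U \<Longrightarrow> U \<noteq> {} \<Longrightarrow> \<exists>y\<in>S. y \<in> U"
    and nz: "\<And>y k. y \<in> S \<Longrightarrow> \<not> (time_avg f (bump y (1 / Suc k)) x \<longlongrightarrow> 0) at_top"
  shows "minimal_center_of_attraction f x UNIV"
  unfolding minimal_center_of_attraction_def
proof (intro conjI allI impI notI)
  show "center_of_attraction f x UNIV"
    unfolding center_of_attraction_def
  proof (intro conjI allI impI closed_UNIV)
    fix e :: real assume "e > 0"
    then have "eps_nbhd e (UNIV :: 'a set) = UNIV"
      by (auto simp: eps_nbhd_def intro!: exI[of _ "_ :: 'a"])
    moreover have "(time_avg f (\<lambda>_. 0) x \<longlongrightarrow> 0) at_top"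
      by (simp add: time_avg_def[abs_def])
    ultimately show "sojourn_prob f x (eps_nbhd e UNIV) 1"
      by (intro sojourn_prob_oneI[where \<phi> = "\<lambda>_. 0"]) auto
  qed
next
  fix D assume "D \<subset> (UNIV :: 'a set)" and D: "center_of_attraction f x D"
  then obtain y where y: "y \<in> S" "y \<in> - D"
    using dense[of "- D"] by (auto simp: center_of_attraction_def open_Compl)
  moreover have "open (- D)"
    using D by (auto simp: center_of_attraction_def)
  ultimately obtain e where e: "e > 0" "ball y e \<subseteq> - D"
    using open_contains_ball by blast
  \<comment> \<open>For a radius \<open>r\<close> below \<open>e / 2\<close>,
    \<open>ball y r\<close> and the \<open>r\<close>-neighborhood of \<open>D\<close> are disjoint
    by the triangle inequality.\<close>
  obtain k where k: "1 / Suc k < e / 2"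
    using nat_approx_posE[of "e / 2"] e(1) by auto
  define r where "r = 1 / real (Suc k)"
  have r: "r > 0" "2 * r \<le> e"
    using k by (auto simp: r_def)
  have "(time_avg f (bump y r) x \<longlongrightarrow> 0) at_top"
  proof (rule time_avg_tendsto_zeroI[OF open_eps_nbhd continuous_on_bump[OF r(1)]])
    show "sojourn_prob f x (eps_nbhd r D) 1"
      using D r by (simp add: center_of_attraction_def)
    fix z
    show "bump y r z \<le> 1 - indicat_real (eps_nbhd r D) z"
    proof (cases "z \<in> eps_nbhd r D")
      case True
      then obtain c where c: "c \<in> D" "dist c z < r"
        by (auto simp: eps_nbhd_def)
      then have "dist y c \<ge> e"
        using e(2) by force
      then have "z \<notin> ball y r"
        using c(2) r(2) dist_triangle[of y c z] by (auto simp: dist_commute)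
      then have "bump y r z \<le> 0"
        using bump_pos_iff[OF r(1)] by (meson not_le)
      then show ?thesis
        by (auto simp: indicator_def)
    qed (simp add: bump_le_one r)
  qed (rule bump_nonneg)
  with nz[OF y(1), of k] show False
    by (simp add: r_def)
qed

section \<open>Averages along the orbit and the \<open_free> G-delta condition\<close>

text \<open>Starting at time \<open>s\<close> discards only an initial integral of at most
  \<open>s\<close>, negligible for large \<open>T\<close>; the drop from \<open>2 * c\<close> to
  \<open>c\<close> absorbs this loss.\<close>

lemma frequently_time_avg_shift:
  assumes \<phi>: "continuous_on UNIV \<phi>" "\<And>z. \<phi> z \<le> 1"
    and c: "c > 0" and s: "s \<ge> 0"
    and freq: "\<exists>\<^sub>F T in at_top. time_avg f \<phi> x T > 2 * c"
  shows "\<exists>\<^sub>F T in at_top. time_avg f \<phi> (f s x) T > c"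
  unfolding frequently_def
proof
  assume "\<forall>\<^sub>F T in at_top. \<not> time_avg f \<phi> (f s x) T > c"
  then obtain N where N: "\<And>T. T \<ge> N \<Longrightarrow> time_avg f \<phi> (f s x) T \<le> c"
    by (auto simp: eventually_at_top_linorder not_less)
  \<comment> \<open>The first bound makes \<open>N\<close> applicable at time \<open>T - s\<close>;
    the second gives \<open>s < c * (T - s)\<close>, which controls the discarded piece.\<close>
  have "\<forall>\<^sub>F T in at_top. T \<ge> N + s \<and> T > s + s / c"
    by (intro eventually_conj eventually_ge_at_top eventually_gt_at_top)
  with freq have "\<exists>\<^sub>F T in at_top. time_avg f \<phi> x T > 2 * c \<and> T \<ge> N + s \<and> T > s + s / c"
    by (rule frequently_rev_mp[OF _ eventually_mono]) auto
  then obtain T where T: "time_avg f \<phi> x T > 2 * c" "T - s \<ge> N" "T > s + s / c"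
    using frequently_ex by (auto simp: algebra_simps)
  let ?g = "\<lambda>t. \<phi> (f t x)"
  have sc: "s / c \<ge> 0" "T > s" "T > 0"
    using s c T(3) by (auto intro: le_less_trans[of _ "s + s / c"] add_nonneg_nonneg)
  have "integral {0..s} ?g \<le> integral {0..s} (\<lambda>_. 1)"
    by (intro integral_le integrable_motion \<phi>) auto
  moreover have "integral {0..s} ?g + integral {s..T} ?g = integral {0..T} ?g"
    by (rule Henstock_Kurzweil_Integration.integral_combine)
      (use s sc in \<open>auto intro!: integrable_motion \<phi>\<close>)
  moreover have "integral {s..T} ?g = integral {0..T - s} (\<lambda>t. \<phi> (f t (f s x)))"
  proof -
    have "integral {s..T} ?g = integral {0..T - s} (\<lambda>t. ?g (t + s))"
      using integral_shift_Icc_real[of 0 "T - s" ?g s] by (simp add: o_def add.commute)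
    also have "\<dots> = integral {0..T - s} (\<lambda>t. \<phi> (f t (f s x)))"
      using sf s by (intro integral_cong) (simp add: semiflow_def add.commute)
    finally show ?thesis .
  qed
  moreover have "2 * c * T < integral {0..T} ?g"
    using T(1) sc by (simp add: time_avg_def field_simps)
  moreover have "integral {0..T - s} (\<lambda>t. \<phi> (f t (f s x))) \<le> c * (T - s)"
    using N[OF T(2)] sc by (simp add: time_avg_def field_simps)
  moreover have "s < c * (T - s)"
    using T(3) c by (simp add: field_simps)
  \<comment> \<open>The integral up to \<open>T\<close> exceeds \<open>2 * c * T\<close> but is at
    most \<open>s + c * (T - s)\<close>, which is below \<open>2 * (c * (T - s))\<close>.\<close>
  ultimately have "2 * c * T < 2 * (c * (T - s))"
    using s by simp
  then show False
    using s c by (simp add: algebra_simps mult_less_0_iff)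
qed

text \<open>A bump that is positive only inside \<open>U\<close> would vanish along an orbit
  avoiding \<open>U\<close>, so all its averages would be 0.\<close>

lemma orbit_meets_open:
  assumes "minimal_center_of_attraction f x UNIV" "open U" "U \<noteq> {}"
  shows "\<exists>s\<ge>0. f s x \<in> U"
proof (rule ccontr)
  assume no: "\<not> (\<exists>s\<ge>0. f s x \<in> U)"
  obtain y r where r: "r > 0" "ball y r \<subseteq> U"
    using assms(2,3) open_contains_ball by blast
  have "bump y r (f t x) = 0" if "t \<ge> 0" for t
    using no that r bump_pos_iff[OF r(1), of y "f t x"] bump_nonneg[of y r "f t x"] by fastforce
  then have "integral {0..T} (\<lambda>t. bump y r (f t x)) = 0" for T
    by (intro integral_eq_0_iff[THEN iffD2] integral_unique has_integral_is_0) auto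
  then have "(time_avg f (bump y r) x \<longlongrightarrow> 0) at_top"
    by (simp add: time_avg_def[abs_def])
  with time_avg_not_tendsto_zero[OF assms(1) r(1)] show False ..
qed

text \<open>Averages of a nonnegative function can fail to tend to 0 only from above. The factor 2
  is the reserve spent in \<open>frequently_time_avg_shift\<close>.\<close>

lemma frequently_time_avg_gt:
  assumes "minimal_center_of_attraction f x UNIV" and r: "r > 0"
  shows "\<exists>c>0. \<exists>\<^sub>F T in at_top. time_avg f (bump y r) x T > 2 * c"
proof (rule ccontr)
  assume no: "\<not> ?thesis"
  have "(time_avg f (bump y r) x \<longlongrightarrow> 0) at_top"
  proof (rule order_tendstoI)
    fix a :: real assume "a < 0"
    moreover have "0 \<le> integral {0..T} (\<lambda>t. bump y r (f t x))" for T
      by (intro integral_nonneg integrable_motion continuous_on_bump r bump_nonneg) simp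
    ultimately have "a < time_avg f (bump y r) x T" if "T > 0" for T
      using that by (auto simp: time_avg_def intro: less_le_trans)
    then show "\<forall>\<^sub>F T in at_top. a < time_avg f (bump y r) x T"
      by (rule eventually_mono[OF eventually_gt_at_top])
  next
    fix a :: real assume a: "0 < a"
    \<comment> \<open>With \<open>a / 4\<close> the averages are eventually at most
      \<open>a / 2\<close>, hence strictly below \<open>a\<close>.\<close>
    with no have "\<not> (\<exists>\<^sub>F T in at_top. time_avg f (bump y r) x T > 2 * (a / 4))"
      by (metis divide_pos_pos zero_less_numeral)
    then show "\<forall>\<^sub>F T in at_top. time_avg f (bump y r) x T < a"
      by (rule eventually_mono[OF not_frequently[THEN iffD1]]) (use a in auto)
  qed
  with time_avg_not_tendsto_zero[OF assms] show False ..
qed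

text \<open>Natural thresholds \<open>n\<close> suffice for large times, so the intersection is
  countable; for each \<open>n\<close> the union over \<open>T \<ge> n\<close> consists of strict
  superlevel sets of continuous functions and is open.\<close>

lemma gdelta_frequently_time_avg:
  assumes "continuous_on UNIV \<phi>"
  shows "gdelta_in euclidean {x. \<exists>\<^sub>F T in at_top. time_avg f \<phi> x T > c}"
proof -
  have "{x. \<exists>\<^sub>F T in at_top. time_avg f \<phi> x T > c}
      = (\<Inter>n::nat. \<Union>T\<in>{real n..}. {x. time_avg f \<phi> x T > c})"
  proof -
    have "(\<exists>\<^sub>F T in at_top. P T) \<longleftrightarrow> (\<forall>n::nat. \<exists>T\<ge>real n. P T)" for P :: "real \<Rightarrow> bool"
      unfolding frequently_def eventually_at_top_linorder
      by (metis order_trans real_arch_simple)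
    then show ?thesis by auto
  qed
  moreover have "gdelta_in euclidean (\<Union>T\<in>{real n..}. {x. time_avg f \<phi> x T > c})" for n
    by (intro open_imp_gdelta_in open_openin[THEN iffD1] open_UN ballI open_Collect_less
        continuous_time_avg assms continuous_on_const)
  ultimately show ?thesis
    by (auto intro!: gdelta_in_Inter)
qed

end

theorem theorem1p4:
  fixes f :: "real \<Rightarrow> 'a::polish_space \<Rightarrow> 'a"
  assumes "semiflow f"
    and "\<exists>x. minimal_center_of_attraction f x UNIV"
  shows "residual_set {x. minimal_center_of_attraction f x UNIV}"
proof -
  obtain x0 where x0: "minimal_center_of_attraction f x0 UNIV"
    using assms(2) by blast
  obtain S :: "'a set" where S: "countable S"
    and dense: "\<And>U. open U \<Longrightarrow> U \<noteq> {} \<Longrightarrow> \<exists>y\<in>S. y \<in> U"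
    using countable_dense_setE by blast
  define \<phi> where "\<phi> y k = bump y (1 / Suc k)" for y :: 'a and k
  have \<phi>: "continuous_on UNIV (\<phi> y k)" "\<phi> y k z \<le> 1" for y k z
    unfolding \<phi>_def by (simp_all add: continuous_on_bump bump_le_one)
  have "\<forall>y k. \<exists>c>0. \<exists>\<^sub>F T in at_top. time_avg f (\<phi> y k) x0 T > 2 * c"
    unfolding \<phi>_def by (intro allI frequently_time_avg_gt[OF assms(1) x0]) simp
  then obtain c where c: "c y k > 0" "\<exists>\<^sub>F T in at_top. time_avg f (\<phi> y k) x0 T > 2 * c y k" for y k
    by metis
  \<comment> \<open>\<open>G\<close> asks only for \<open>c y k\<close> although the averages at
    \<open>x0\<close> exceed \<open>2 * c y k\<close>; this slack lets every orbit point in.\<close>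
  define G where "G y k = {x. \<exists>\<^sub>F T in at_top. time_avg f (\<phi> y k) x T > c y k}" for y k
  define H where "H = (\<Inter>(y, k)\<in>S \<times> UNIV. G y k)"
  have "S \<noteq> {}"
    using dense[of UNIV] by auto
  then have "gdelta_in euclidean H"
    unfolding H_def G_def using S
    by (intro gdelta_in_Inter) (auto intro!: gdelta_frequently_time_avg[OF assms(1)] \<phi>)
  moreover have "H \<subseteq> {x. minimal_center_of_attraction f x UNIV}"
  proof clarify
    fix x assume "x \<in> H"
    show "minimal_center_of_attraction f x UNIV"
    proof (rule minimal_center_of_attraction_UNIVI[OF assms(1) dense])
      fix y k assume "y \<in> S"
      with \<open>x \<in> H\<close> have freq: "\<exists>\<^sub>F T in at_top. time_avg f (\<phi> y k) x T > c y k"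
        by (auto simp: H_def G_def)
      show "\<not> (time_avg f (bump y (1 / Suc k)) x \<longlongrightarrow> 0) at_top"
      proof
        assume "(time_avg f (bump y (1 / Suc k)) x \<longlongrightarrow> 0) at_top"
        then have "\<forall>\<^sub>F T in at_top. time_avg f (\<phi> y k) x T < c y k"
          using c(1)[of y k] by (auto simp: \<phi>_def dest: order_tendstoD)
        with freq show False
          by (auto simp: frequently_def elim!: notE eventually_mono)
      qed
    qed
  qed
  moreover have "closure H = UNIV"
  proof -
    have orbit: "f s x0 \<in> H" if "s \<ge> 0" for s
      using frequently_time_avg_shift[OF assms(1) \<phi> c(1) that c(2)] by (auto simp: H_def G_def)
    \<comment> \<open>If this open set were nonempty, the orbit would meet it, yet the orbit lies in
      \<open>H\<close>.\<close>
    have "- closure H = {}"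
      using orbit orbit_meets_open[OF assms(1) x0, of "- closure H"] closure_subset[of H]
      by (auto simp: open_Compl)
    then show ?thesis by auto
  qed
  ultimately show ?thesis
    unfolding residual_set_def by blast
qed

end
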